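(* Let $p$ be an odd prime and let $a,b,c$ be integers with $0<a,b,c<p$ such that $a+b+c\ge 2p-1$. Then the following hold in $\mathbb F_p$. (i) If $a+b+2c\le 3p-2$, then $$\bar S(a,b,c;2,2)=-\frac{(2c)!}{c!}\,\frac{a!\,(a+c-p)!\,b!\,(b+c-p)!}{(a+b+c-2p+1)!\,(a+b+2c-2p+1)!},$$ and this expression is non-zero if and only if $2c<p$. (ii) If $3p-1\le a+b+2c$, then $2c>p$ and $$\bar S(a,b,c;2,2)=-\frac{(2c-p)!}{c!}\,\frac{a!\,(a+c-p)!\,b!\,(b+c-p)!}{(a+b+c-2p+1)!\,(a+b+2c-3p+1)!},$$ and this expression is non-zero.
   Context: For non-negative integers $a,b,c$ let $\Phi(x_1,x_2;a,b,c)=(x_1-x_2)^{2c}\,x_1^a x_2^a(1-x_1)^b(1-x_2)^b\in\mathbb Z[x_1,x_2]$. For positive integers $l_1,l_2$, let $S(a,b,c;l_1,l_2)\in\mathbb Z$ be the coefficient of $x_1^{l_1p-1}x_2^{l_2p-1}$ in $\Phi(x_1,x_2;a,b,c)$, and let $\bar S(a,b,c;l_1,l_2)\in\mathbb F_p$ be its reduction modulo $p$. Factorials are factorials of non-negative integers, projected to $\mathbb F_p$, and quotients are taken in $\mathbb F_p$. *)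

theory Defs
  imports "Berlekamp_Zassenhaus.Finite_Field" "HOL-Computational_Algebra.Polynomial"
begin

text \<open>
  Elements of \<open>\<int>[x\<^sub>1, x\<^sub>2]\<close> are represented as \<open>(\<int>[x\<^sub>1])[x\<^sub>2]\<close>, i.e. by the type
  \<^typ>\<open>int poly poly\<close>: the inner variable is \<open>x\<^sub>1\<close>, the outer one is \<open>x\<^sub>2\<close>. The field \<open>\<F>\<^sub>p\<close> is the
  type \<open>'p mod_ring\<close> of integers modulo \<open>p = CARD('p)\<close>, with \<open>'p\<close> of class \<open>prime_card\<close>
  (that is, \<open>p\<close> is prime).
\<close>

definition X1 :: "int poly poly" where
  "X1 = [:[:0, 1:]:]"

definition X2 :: "int poly poly" where
  "X2 = [:0, 1:]"

definition Phi :: "nat \<Rightarrow> nat \<Rightarrow> nat \<Rightarrow> int poly poly" where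
  "Phi a b c = (X1 - X2) ^ (2 * c) * X1 ^ a * X2 ^ a * (1 - X1) ^ b * (1 - X2) ^ b"

text \<open>
  The coefficient of \<open>x\<^sub>1\<close> to the power \<open>l\<^sub>1 p - 1\<close> times \<open>x\<^sub>2\<close> to the power \<open>l\<^sub>2 p - 1\<close> in
  \<open>\<Phi>(x\<^sub>1, x\<^sub>2; a, b, c)\<close>. It is meant for positive \<open>p\<close>, \<open>l\<^sub>1\<close>, \<open>l\<^sub>2\<close>, where the natural number
  subtraction does not truncate.
\<close>

definition S :: "nat \<Rightarrow> nat \<Rightarrow> nat \<Rightarrow> nat \<Rightarrow> nat \<Rightarrow> nat \<Rightarrow> int" where
  "S p a b c l1 l2 = coeff (coeff (Phi a b c) (l2 * p - 1)) (l1 * p - 1)"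

definition S_bar :: "nat \<Rightarrow> nat \<Rightarrow> nat \<Rightarrow> nat \<Rightarrow> nat \<Rightarrow> 'p::prime_card mod_ring" where
  "S_bar a b c l1 l2 = of_int (S CARD('p) a b c l1 l2)"

text \<open>
  The projection of \<open>n!\<close> to \<open>\<F>\<^sub>p\<close>. The overloaded \<^const>\<open>fact\<close> is only available in
  characteristic zero.
\<close>

definition fact_mod :: "nat \<Rightarrow> 'p::prime_card mod_ring" where
  "fact_mod n = of_nat (fact n)"

end

theory Submission
  imports Defs
begin

text \<open>
  Expanding \<open>(x\<^sub>1 - x\<^sub>2)\<close> to the power \<open>2c\<close> writes the coefficient as an alternating sum of products of
  three binomial coefficients, and Dixon's identity evaluates this sum over the integers:
  \[ S(a,b,c;2,2) = (-1)^c \, \frac{(2c)! \, b! \, (b+c)!}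
     {c! \, (2p-1-a-c)! \, (a+b+c-2p+1)! \, (2p-1-a)! \, (a+b+2c-2p+1)!}. \]
  Here \<open>(b+c)!\<close> and \<open>(2p-1-a)!\<close> contain exactly one factor \<open>p\<close> each, and so do, in case (ii),
  \<open>(2c)!\<close> and \<open>(a+b+2c-2p+1)!\<close>. These factors cancel because \<open>(p+n)! / p \<equiv> - n!\<close> modulo \<open>p\<close>, and
  Wilson's theorem in the form \<open>n! (p-1-n)! \<equiv> (-1)\<close> to the power \<open>n+1\<close> moves
  \<open>(p-1-a)!\<close> and \<open>(2p-1-a-c)!\<close> to the numerator.
\<close>

section \<open>Reciprocal factorials and Dixon's identity\<close>

text \<open>
  The reciprocal factorial, extended by \<open>0\<close> to the negative integers: its recurrence then holds on all
  of \<open>\<int>\<close>, and sums of products of reciprocal factorials cut themselves off.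
\<close>
definition rfact :: "int \<Rightarrow> rat" where
  "rfact x = (if x < 0 then 0 else 1 / fact (nat x))"

lemma rfact_neg: "x < 0 \<Longrightarrow> rfact x = 0"
  by (simp add: rfact_def)

lemma rfact_of_nat: "rfact (int n) = 1 / fact n"
  by (simp add: rfact_def)

text \<open>At \<open>x = -1\<close> the factor \<open>x + 1\<close> vanishes, which agrees with the
  default value 0 to the left of 0.\<close>

lemma rfact_rec: "rfact x = of_int (x + 1) * rfact (x + 1)"
proof -
  consider "x < -1" | "x = -1" | "x \<ge> 0" by linarith
  then show ?thesis
  proof cases
    case 3
    then have "nat (x + 1) = Suc (nat x)" by simp
    moreover have "of_int x + 1 \<noteq> (0 :: rat)" using 3 by linarith
    ultimately show ?thesis using 3 by (simp add: rfact_def add.commute)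
  qed (auto simp: rfact_def)
qed

text \<open>For \<open>k > n\<close> both sides vanish, the right one through the default value of
  \<open>rfact\<close>.\<close>

lemma binomial_rfact: "of_nat (n choose k) = fact n * rfact (int k) * rfact (int n - int k)"
proof (cases "k \<le> n")
  case True
  then have "int n - int k = int (n - k)" by simp
  with True show ?thesis by (simp only: rfact_of_nat binomial_fact) simp
qed (simp add: rfact_neg)

text \<open>
  The summation index is \<open>j = k - L\<close>, for a bound \<open>L\<close> that does not depend on \<open>l\<close>. The function \<open>G\<close> in
  the proof is the Wilf-Zeilberger certificate of Dixon's identity.
\<close>
lemma sum_rfact_recurrence:
  fixes l m n L :: nat
  assumes "l < L"
  defines "t \<equiv> (\<lambda>l k. (-1) ^ k * rfact (int l + (int k - int L)) * rfact (int l - (int k - int L))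
    * rfact (int m + (int k - int L)) * rfact (int m - (int k - int L))
    * rfact (int n + (int k - int L)) * rfact (int n - (int k - int L)))"
  shows "of_nat ((l + m + 1) * (l + n + 1) * (l + 1)) * (\<Sum>k\<le>2 * L. t (Suc l) k)
       = of_nat (l + m + n + 1) * (\<Sum>k\<le>2 * L. t l k)"
proof -
  define G where "G = (\<lambda>k. (-1) ^ Suc k / 2 * rfact (int l + (int k - int L)) * rfact (int l + 1 - (int k - int L))
    * rfact (int m + (int k - int L) - 1) * rfact (int m - (int k - int L))
    * rfact (int n + (int k - int L) - 1) * rfact (int n - (int k - int L)))"
  have step: "of_nat ((l + m + 1) * (l + n + 1) * (l + 1)) * t (Suc l) k - of_nat (l + m + n + 1) * t l k
    = G (Suc k) - G k" for k
  proof -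
    define j where "j = int k - int L"
    have e: "int (Suc k) - int L = j + 1" by (simp add: j_def)
    \<comment> \<open>For each type of factor this is the largest argument occurring in the four
      terms. The recurrence makes every other factor a polynomial multiple of these six, so the
      claim becomes a polynomial identity in \<open>l\<close>, \<open>m\<close>, \<open>n\<close>,
      \<open>j\<close>.\<close>
    define A B C D E F where "A = rfact (int l + 1 + j)" and "B = rfact (int l + 1 - j)"
      and "C = rfact (int m + j)" and "D = rfact (int m - j)"
      and "E = rfact (int n + j)" and "F = rfact (int n - j)"
    have 1: "rfact (int l + j) = of_int (int l + j + 1) * A"
      using rfact_rec[of "int l + j"] by (simp add: A_def algebra_simps)
    have 2: "rfact (int l - j) = of_int (int l - j + 1) * B"
      using rfact_rec[of "int l - j"] by (simp add: B_def algebra_simps)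
    have 3: "rfact (int m + j - 1) = of_int (int m + j) * C"
      using rfact_rec[of "int m + j - 1"] by (simp add: C_def algebra_simps)
    have 4: "rfact (int m - (j + 1)) = of_int (int m - j) * D"
      using rfact_rec[of "int m - (j + 1)"] by (simp add: D_def algebra_simps)
    have 5: "rfact (int n + j - 1) = of_int (int n + j) * E"
      using rfact_rec[of "int n + j - 1"] by (simp add: E_def algebra_simps)
    have 6: "rfact (int n - (j + 1)) = of_int (int n - j) * F"
      using rfact_rec[of "int n - (j + 1)"] by (simp add: F_def algebra_simps)
    have t1: "t (Suc l) k = (-1) ^ k * A * B * C * D * E * F"
      unfolding t_def j_def[symmetric] A_def B_def C_def D_def E_def F_def by (simp add: algebra_simps)
    have t0: "t l k = (-1) ^ k * (of_int (int l + j + 1) * A) * (of_int (int l - j + 1) * B) * C * D * E * F"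
      unfolding t_def j_def[symmetric] 1 2 C_def D_def E_def F_def ..
    have G0: "G k = (-1) ^ Suc k / 2 * (of_int (int l + j + 1) * A) * B * (of_int (int m + j) * C) * D * (of_int (int n + j) * E) * F"
      unfolding G_def j_def[symmetric] 1 3 5 B_def D_def F_def ..
    have a: "int l + (j + 1) = int l + 1 + j" "int l + 1 - (j + 1) = int l - j"
      "int m + (j + 1) - 1 = int m + j" "int n + (j + 1) - 1 = int n + j" by auto
    have G1: "G (Suc k) = (-1) ^ k / 2 * A * (of_int (int l - j + 1) * B) * C * (of_int (int m - j) * D) * E * (of_int (int n - j) * F)"
      unfolding G_def e a 2 4 6 A_def[symmetric] C_def[symmetric] E_def[symmetric] by simp
    show ?thesis
      unfolding t1 t0 G0 G1 by (simp add: field_simps)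
  qed
  \<comment> \<open>Here \<open>l < L\<close> enters: with shifts \<open>-L\<close> and
    \<open>L + 1\<close> the two arguments both equal \<open>l - L\<close>, so \<open>G\<close>
    vanishes at both ends of the telescoping sum.\<close>
  have "rfact (int l + (0 - int L)) = 0" "rfact (int l + 1 - (int (Suc (2 * L)) - int L)) = 0"
    using assms(1) by (auto intro!: rfact_neg)
  then have "G 0 = 0" "G (Suc (2 * L)) = 0"
    by (simp_all only: G_def of_nat_0 mult_zero_left mult_zero_right)
  then have "(\<Sum>k\<le>2 * L. G (Suc k) - G k) = 0"
    unfolding lessThan_Suc_atMost[symmetric] by (subst sum_lessThan_telescope) simp
  then show ?thesis
    unfolding step[symmetric] sum_subtractf sum_distrib_left[symmetric] by simp
qed

text \<open>Induction on \<open>l\<close> with the window fixed by \<open>L\<close>. For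
  \<open>l = 0\<close> only the central term \<open>k = L\<close> survives, and it carries the sign
  \<open>(-1) ^ L\<close>; the recurrence does the rest.\<close>

lemma dixon_rfact:
  fixes l m n L :: nat
  assumes "l \<le> L"
  shows "(\<Sum>k\<le>2 * L. (-1) ^ k * rfact (int l + (int k - int L)) * rfact (int l - (int k - int L))
    * rfact (int m + (int k - int L)) * rfact (int m - (int k - int L))
    * rfact (int n + (int k - int L)) * rfact (int n - (int k - int L)))
    = (-1) ^ L * fact (l + m + n) / (fact l * fact m * fact n * fact (l + m) * fact (m + n) * fact (n + l))"
  using assms
proof (induction l)
  case 0
  have "(\<Sum>k\<le>2 * L. (-1) ^ k * rfact (int 0 + (int k - int L)) * rfact (int 0 - (int k - int L))
    * rfact (int m + (int k - int L)) * rfact (int m - (int k - int L))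
    * rfact (int n + (int k - int L)) * rfact (int n - (int k - int L)))
    = (\<Sum>k\<in>{L}. (-1) ^ k * rfact (int 0 + (int k - int L)) * rfact (int 0 - (int k - int L))
    * rfact (int m + (int k - int L)) * rfact (int m - (int k - int L))
    * rfact (int n + (int k - int L)) * rfact (int n - (int k - int L)))"
  proof (rule sum.mono_neutral_right)
    show "\<forall>k\<in>{..2 * L} - {L}. (-1) ^ k * rfact (int 0 + (int k - int L)) * rfact (int 0 - (int k - int L))
      * rfact (int m + (int k - int L)) * rfact (int m - (int k - int L))
      * rfact (int n + (int k - int L)) * rfact (int n - (int k - int L)) = 0"
    proof
      fix k assume "k \<in> {..2 * L} - {L}"
      then have "int k < int L \<or> int k > int L" by auto
      then show "(-1) ^ k * rfact (int 0 + (int k - int L)) * rfact (int 0 - (int k - int L))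
        * rfact (int m + (int k - int L)) * rfact (int m - (int k - int L))
        * rfact (int n + (int k - int L)) * rfact (int n - (int k - int L)) = 0"
        by (auto simp: rfact_neg)
    qed
  qed auto
  then show ?case
    by (simp add: rfact_def field_simps)
next
  case (Suc l)
  define T where "T = (\<lambda>l. \<Sum>k\<le>2 * L. (-1) ^ k * rfact (int l + (int k - int L)) * rfact (int l - (int k - int L))
    * rfact (int m + (int k - int L)) * rfact (int m - (int k - int L))
    * rfact (int n + (int k - int L)) * rfact (int n - (int k - int L)))"
  have IH: "T l = (-1) ^ L * fact (l + m + n) / (fact l * fact m * fact n * fact (l + m) * fact (m + n) * fact (n + l))"
    using Suc unfolding T_def by simp
  define q :: rat where "q = of_nat ((l + m + 1) * (l + n + 1) * (l + 1))"
  have q: "q \<noteq> 0" unfolding q_def of_nat_eq_0_iff by simp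
  have "q * T (Suc l) = of_nat (l + m + n + 1) * T l"
    unfolding q_def T_def using Suc.prems by (intro sum_rfact_recurrence) simp
  then have T: "T (Suc l) = of_nat (l + m + n + 1) * T l / q"
    using q by (simp add: field_simps)
  \<comment> \<open>The three factors of \<open>q\<close> are the growth of \<open>fact l\<close>,
    \<open>fact (l + m)\<close> and \<open>fact (n + l)\<close> when \<open>l\<close> increases by
    one.\<close>
  have f: "fact (Suc l + m + n) = of_nat (l + m + n + 1) * (fact (l + m + n) :: rat)"
    "fact (Suc l) * fact m * fact n * fact (Suc l + m) * fact (m + n) * fact (n + Suc l)
      = q * (fact l * fact m * fact n * fact (l + m) * fact (m + n) * fact (n + l))"
    by (simp_all add: q_def algebra_simps)
  have "T (Suc l) = (-1) ^ L * fact (Suc l + m + n)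
      / (fact (Suc l) * fact m * fact n * fact (Suc l + m) * fact (m + n) * fact (n + Suc l))"
    unfolding f T IH by (simp add: mult_ac)
  then show ?case unfolding T_def .
qed

section \<open>Coefficients of \<open>Phi\<close>\<close>

lemma coeff_monom_mult_one_minus_power:
  fixes a b n :: nat
  shows "coeff ([:0, 1:] ^ a * (1 - [:0, 1:]) ^ b :: 'a :: comm_ring_1 poly) n
    = (if n < a then 0 else (-1) ^ (n - a) * of_nat (b choose (n - a)))"
proof -
  have 1: "[:0, 1:] ^ a = monom (1 :: 'a) a" by (simp add: monom_altdef)
  have 2: "1 - [:0, 1:] = [:1, - (1 :: 'a):]" by (simp add: one_pCons)
  show ?thesis
    unfolding 1 2
  proof (cases "n - a \<le> b")
    case True
    then show "coeff (monom 1 a * [:1, - (1 :: 'a):] ^ b) n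
      = (if n < a then 0 else (-1) ^ (n - a) * of_nat (b choose (n - a)))"
      by (simp add: coeff_monom_mult coeff_linear_poly_power mult.commute)
  next
    case False
    have "degree ([:1, - (1 :: 'a):] ^ b) \<le> degree [:1, - (1 :: 'a):] * b"
      by (rule degree_power_le)
    with False have "degree ([:1, - (1 :: 'a):] ^ b) < n - a" by simp
    then have "coeff ([:1, - (1 :: 'a):] ^ b) (n - a) = 0" by (rule coeff_eq_0)
    with False show "coeff (monom 1 a * [:1, - (1 :: 'a):] ^ b) n
      = (if n < a then 0 else (-1) ^ (n - a) * of_nat (b choose (n - a)))"
      by (simp add: coeff_monom_mult binomial_eq_0)
  qed
qed

text \<open>The binomial theorem for \<open>(X1 - X2) ^ (2 * c)\<close> separates the variables in
  each term, so the double coefficient of a term is a product of two univariate ones.\<close>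

lemma coeff_coeff_Phi:
  "coeff (coeff (Phi a b c) n2) n1 = (\<Sum>k\<le>2 * c. (-1) ^ k * of_nat ((2 * c) choose k)
     * coeff ([:0, 1:] ^ (a + k) * (1 - [:0, 1:]) ^ b) n1
     * coeff ([:0, 1:] ^ (a + (2 * c - k)) * (1 - [:0, 1:]) ^ b) n2)"
proof -
  define u :: "int poly" where "u = [:0, 1:]"
  define P where "P = (\<lambda>i. u ^ i * (1 - u) ^ b)"
  have "(X1 - X2) ^ (2 * c) = (- X2 + X1) ^ (2 * c)"
    by simp
  also have "\<dots> = (X1 + - X2) ^ (2 * c)" by (simp only: add.commute)
  also have "\<dots> = (\<Sum>k\<le>2 * c. of_nat ((2 * c) choose k) * X1 ^ k * (- X2) ^ (2 * c - k))"
    by (rule binomial_ring)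
  also have "\<dots> = (\<Sum>k\<le>2 * c. (-1) ^ k * of_nat ((2 * c) choose k) * X1 ^ k * X2 ^ (2 * c - k))"
  proof (rule sum.cong[OF refl])
    fix k assume "k \<in> {..2 * c}"
    then have "even (2 * c - k) \<longleftrightarrow> even k" by simp
    then have "(- X2) ^ (2 * c - k) = (-1) ^ k * X2 ^ (2 * c - k)"
      by (auto simp: minus_one_power_iff power_minus[of X2])
    then show "of_nat ((2 * c) choose k) * X1 ^ k * (- X2) ^ (2 * c - k)
      = (-1) ^ k * of_nat ((2 * c) choose k) * X1 ^ k * X2 ^ (2 * c - k)" by simp
  qed
  finally have "Phi a b c = (\<Sum>k\<le>2 * c. (-1) ^ k * of_nat ((2 * c) choose k) * X1 ^ k * X2 ^ (2 * c - k))
     * X1 ^ a * X2 ^ a * (1 - X1) ^ b * (1 - X2) ^ b"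
    by (simp add: Phi_def)
  also have "\<dots> = (\<Sum>k\<le>2 * c. (-1) ^ k * of_nat ((2 * c) choose k)
     * (X1 ^ (a + k) * (1 - X1) ^ b) * (X2 ^ (a + (2 * c - k)) * (1 - X2) ^ b))"
    unfolding sum_distrib_right by (rule sum.cong) (simp_all only: power_add mult_ac)
  also have "\<dots> = (\<Sum>k\<le>2 * c. smult ((-1) ^ k * of_nat ((2 * c) choose k) * P (a + k))
     (X2 ^ (a + (2 * c - k)) * (1 - X2) ^ b))"
  \<comment> \<open>A polynomial in \<open>x1\<close> alone is a constant of the outer ring, so
    multiplying by it is \<open>smult\<close>.\<close>
  proof (rule sum.cong[OF refl])
    fix k
    have "1 - X1 = [:1 - u:]" by (simp add: X1_def u_def one_pCons)
    then have 1: "X1 ^ (a + k) * (1 - X1) ^ b = [:P (a + k):]"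
      by (simp add: X1_def P_def poly_const_pow flip: u_def)
    have 2: "(-1) ^ k * of_nat ((2 * c) choose k) = [:(-1) ^ k * of_nat ((2 * c) choose k) :: int poly:]"
      by (cases "even k") (simp_all add: of_nat_poly)
    show "(-1) ^ k * of_nat ((2 * c) choose k)
       * (X1 ^ (a + k) * (1 - X1) ^ b) * (X2 ^ (a + (2 * c - k)) * (1 - X2) ^ b)
       = smult ((-1) ^ k * of_nat ((2 * c) choose k) * P (a + k)) (X2 ^ (a + (2 * c - k)) * (1 - X2) ^ b)"
      unfolding 1 2 by (simp add: mult_ac)
  qed
  finally have "coeff (Phi a b c) n2 = (\<Sum>k\<le>2 * c. (-1) ^ k * of_nat ((2 * c) choose k) * P (a + k)
     * coeff (X2 ^ (a + (2 * c - k)) * (1 - X2) ^ b) n2)"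
    by (simp add: coeff_sum)
  also have "\<dots> = (\<Sum>k\<le>2 * c. smult ((-1) ^ k * of_nat ((2 * c) choose k)
     * coeff (P (a + (2 * c - k))) n2) (P (a + k)))"
  proof (rule sum.cong[OF refl])
    fix k
    have const: "(-1) ^ i * of_nat j = [:(-1) ^ i * of_nat j :: int:]" for i j
      by (cases "even i") (simp_all add: of_nat_poly)
    \<comment> \<open>The coefficient formula holds over \<open>int poly\<close> and over
      \<open>int\<close> alike, and its value is an integer constant.\<close>
    have 1: "coeff (X2 ^ (a + (2 * c - k)) * (1 - X2) ^ b) n2 = [:coeff (P (a + (2 * c - k))) n2:]"
      unfolding X2_def P_def u_def coeff_monom_mult_one_minus_power const by simp
    show "(-1) ^ k * of_nat ((2 * c) choose k) * P (a + k)
     * coeff (X2 ^ (a + (2 * c - k)) * (1 - X2) ^ b) n2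
     = smult ((-1) ^ k * of_nat ((2 * c) choose k) * coeff (P (a + (2 * c - k))) n2) (P (a + k))"
      unfolding 1 const by (simp add: mult_ac)
  qed
  finally show ?thesis
    by (simp add: coeff_sum P_def u_def mult_ac)
qed

text \<open>The sign is written with \<open>n + a\<close>, of the same parity as
  \<open>n - a\<close> but free of truncation; outside the support the zeros of \<open>rfact\<close>
  take over.\<close>

lemma coeff_monom_mult_one_minus_power_rfact:
  "of_int (coeff ([:0, 1:] ^ a * (1 - [:0, 1:]) ^ b) n)
    = (-1) ^ (n + a) * fact b * rfact (int n - int a) * rfact (int b + int a - int n)"
proof (cases "n < a")
  case True
  then show ?thesis by (simp add: coeff_monom_mult_one_minus_power rfact_neg)
next
  case False
  then have 1: "int n - int a = int (n - a)" "int b + int a - int n = int b - int (n - a)"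
    and 2: "even (n - a) \<longleftrightarrow> even (n + a)" by auto
  show ?thesis
    unfolding 1 coeff_monom_mult_one_minus_power
    using False 2 by (simp add: binomial_rfact minus_one_power_iff)
qed

text \<open>
  With \<open>N = n - a - c\<close> and \<open>M = a + b + c - n\<close>, so that \<open>N + M = b\<close>, the two binomial coefficients
  \<open>b choose (N - j)\<close> and \<open>b choose (N + j)\<close> together have the factorials of \<open>N \<plusminus> j\<close> and \<open>M \<plusminus> j\<close>
  as denominators: the coefficient is a Dixon sum with parameters \<open>c, N, M\<close>.
\<close>
lemma coeff_coeff_Phi_closed_form:
  fixes a b c n :: nat
  assumes "a + c \<le> n" "n \<le> a + b + c"
  shows "coeff (coeff (Phi a b c) n) n * (fact c * fact (n - a - c) * fact (a + b + c - n)
      * fact (n - a) * fact (a + b + 2 * c - n)) = (-1) ^ c * fact (2 * c) * fact b * fact (b + c)"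
proof -
  define N where "N = n - a - c"
  define M where "M = a + b + c - n"
  have NM: "c + N + M = b + c" "N + M = b" "c + N = n - a" "M + c = a + b + 2 * c - n"
    using assms by (auto simp: N_def M_def)
  have N': "int N = int n - int a - int c" and M': "int M = int a + int b + int c - int n"
    using assms by (auto simp: N_def M_def of_nat_diff)
  have "of_int (coeff (coeff (Phi a b c) n) n) = (\<Sum>k\<le>2 * c. fact (2 * c) * (fact b)\<^sup>2 *
    ((-1) ^ k * rfact (int c + (int k - int c)) * rfact (int c - (int k - int c))
    * rfact (int N + (int k - int c)) * rfact (int N - (int k - int c))
    * rfact (int M + (int k - int c)) * rfact (int M - (int k - int c))))"
    unfolding coeff_coeff_Phi of_int_sum
  proof (rule sum.cong[OF refl])
    fix k assume "k \<in> {..2 * c}"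
    then have k: "k \<le> 2 * c" by simp
    have e: "int n - int (a + k) = int N - (int k - int c)"
      "int b + int (a + k) - int n = int M + (int k - int c)"
      "int n - int (a + (2 * c - k)) = int N + (int k - int c)"
      "int b + int (a + (2 * c - k)) - int n = int M - (int k - int c)"
      "int (2 * c) - int k = int c - (int k - int c)"
      using k by (auto simp: N' M' of_nat_diff)
    have e0: "rfact (int k) = rfact (int c + (int k - int c))" by simp
    \<comment> \<open>The exponents add up to \<open>2 * (n + a + c)\<close>, so only the sign
      \<open>(-1) ^ k\<close> of the binomial expansion remains.\<close>
    have sgn: "(-1) ^ (n + (a + k)) * (-1) ^ (n + (a + (2 * c - k))) = (1 :: rat)"
      using k by (auto simp: minus_one_power_iff)
    have "of_int ((-1) ^ k * of_nat (2 * c choose k) *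
          coeff ([:0, 1:] ^ (a + k) * (1 - [:0, 1:]) ^ b) n *
          coeff ([:0, 1:] ^ (a + (2 * c - k)) * (1 - [:0, 1:]) ^ b) n)
      = (-1) ^ k * (fact (2 * c) * rfact (int k) * rfact (int (2 * c) - int k))
        * ((-1) ^ (n + (a + k)) * fact b * rfact (int n - int (a + k)) * rfact (int b + int (a + k) - int n))
        * ((-1) ^ (n + (a + (2 * c - k))) * fact b * rfact (int n - int (a + (2 * c - k)))
           * rfact (int b + int (a + (2 * c - k)) - int n))"
      by (simp only: of_int_mult of_int_power of_int_minus of_int_1 of_int_of_nat_eq binomial_rfact
        coeff_monom_mult_one_minus_power_rfact)
    also have "\<dots> = (-1) ^ k * (fact (2 * c) * rfact (int c + (int k - int c)) * rfact (int c - (int k - int c)))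
        * ((-1) ^ (n + (a + k)) * fact b * rfact (int N - (int k - int c)) * rfact (int M + (int k - int c)))
        * ((-1) ^ (n + (a + (2 * c - k))) * fact b * rfact (int N + (int k - int c)) * rfact (int M - (int k - int c)))"
      by (simp only: e e0)
    also have "\<dots> = ((-1) ^ (n + (a + k)) * (-1) ^ (n + (a + (2 * c - k)))) * (fact (2 * c) * (fact b)\<^sup>2 *
      ((-1) ^ k * rfact (int c + (int k - int c)) * rfact (int c - (int k - int c))
      * rfact (int N + (int k - int c)) * rfact (int N - (int k - int c))
      * rfact (int M + (int k - int c)) * rfact (int M - (int k - int c))))"
      by (simp only: power2_eq_square mult_ac)
    finally show "of_int ((-1) ^ k * of_nat (2 * c choose k) *
          coeff ([:0, 1:] ^ (a + k) * (1 - [:0, 1:]) ^ b) n *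
          coeff ([:0, 1:] ^ (a + (2 * c - k)) * (1 - [:0, 1:]) ^ b) n)
       = fact (2 * c) * (fact b)\<^sup>2 *
      ((-1) ^ k * rfact (int c + (int k - int c)) * rfact (int c - (int k - int c))
      * rfact (int N + (int k - int c)) * rfact (int N - (int k - int c))
      * rfact (int M + (int k - int c)) * rfact (int M - (int k - int c)))"
      unfolding sgn mult_1_left .
  qed
  \<comment> \<open>Dixon's identity with \<open>l = L = c\<close>: the window is then exactly the
    range of the binomial expansion.\<close>
  also have "\<dots> = fact (2 * c) * (fact b)\<^sup>2 * ((-1) ^ c * fact (c + N + M)
      / (fact c * fact N * fact M * fact (c + N) * fact (N + M) * fact (M + c)))"
    unfolding sum_distrib_left[symmetric] by (subst dixon_rfact) simp_all
  finally have "of_int (coeff (coeff (Phi a b c) n) n) = fact (2 * c) * (fact b)\<^sup>2 * ((-1) ^ c * fact (b + c)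
      / (fact c * fact N * fact M * fact (n - a) * fact b * fact (a + b + 2 * c - n)) :: rat)"
    unfolding NM(1) unfolding NM(2-4) .
  then have "of_int (coeff (coeff (Phi a b c) n) n) * (fact c * fact N * fact M
      * fact (n - a) * fact (a + b + 2 * c - n)) = ((-1) ^ c * fact (2 * c) * fact b * fact (b + c) :: rat)"
    by (simp add: field_simps power2_eq_square)
  then have "(of_int (coeff (coeff (Phi a b c) n) n * (fact c * fact N * fact M
      * fact (n - a) * fact (a + b + 2 * c - n))) :: rat) = of_int ((-1) ^ c * fact (2 * c) * fact b * fact (b + c))"
    by simp
  then show ?thesis
    unfolding of_int_eq_iff N_def M_def .
qed

section \<open>Factorials modulo p\<close>

lemma of_nat_mod_ring_eq_0_iff:
  "(of_nat n :: 'p::prime_card mod_ring) = 0 \<longleftrightarrow> CARD('p) dvd n"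
  by (simp add: of_nat_eq_0_iff_char_dvd)

lemma fact_mod_eq_0_iff: "(fact_mod n :: 'p::prime_card mod_ring) = 0 \<longleftrightarrow> CARD('p) \<le> n"
  by (simp add: fact_mod_def of_nat_mod_ring_eq_0_iff prime_dvd_fact_iff prime_card)

lemma fact_mod_Suc: "fact_mod (Suc n) = of_nat (Suc n) * fact_mod n"
  by (simp add: fact_mod_def distrib_right)

lemma fact_mod_wilson: "(fact_mod (CARD('p) - 1) :: 'p::prime_card mod_ring) = -1"
proof -
  have "[fact (CARD('p) - 1) = -1] (mod int CARD('p))"
    using prime_card by (rule wilson_theorem)
  then have "(of_int (fact (CARD('p) - 1)) :: 'p mod_ring) = of_int (-1)"
    by (simp only: of_int_eq_iff_cong_CHAR semiring_char_mod_ring)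
  then show ?thesis by (metis fact_mod_def of_int_1 of_int_minus of_int_of_nat_eq of_nat_fact)
qed

text \<open>Starting from Wilson's theorem, each step trades the factor \<open>p - 1 - n\<close> for
  \<open>n + 1\<close>, and these are negatives of each other modulo p.\<close>

lemma fact_mod_reflect:
  "n < CARD('p) \<Longrightarrow> (fact_mod n * fact_mod (CARD('p) - 1 - n) :: 'p::prime_card mod_ring) = (-1) ^ (n + 1)"
proof (induction n)
  case 0
  then show ?case using fact_mod_wilson by (simp add: fact_mod_def)
next
  case (Suc n)
  define m where "m = CARD('p) - 1 - Suc n"
  have m: "CARD('p) - 1 - n = Suc m" using Suc.prems by (simp add: m_def)
  have "of_nat (Suc n) + of_nat (Suc m) = (of_nat CARD('p) :: 'p mod_ring)"
    unfolding of_nat_add[symmetric] using Suc.prems by (simp add: m_def)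
  then have "of_nat (Suc n) = - (of_nat (Suc m) :: 'p mod_ring)"
    using of_nat_card_eq_0 by (simp only: eq_neg_iff_add_eq_0)
  then have "(fact_mod (Suc n) * fact_mod m :: 'p mod_ring) = - (fact_mod n * fact_mod (Suc m))"
    unfolding fact_mod_Suc by (simp only: mult_ac mult_minus_left mult_minus_right)
  also have "\<dots> = (-1) ^ (Suc n + 1)"
    using Suc.IH Suc.prems unfolding m by simp
  finally show ?case unfolding m_def .
qed

text \<open>The quotient \<open>K\<close> is kept as a natural number because p has to be cancelled
  before reduction. Wilson's theorem is the base case; each step multiplies by
  \<open>p + Suc n\<close>, which reduces to \<open>Suc n\<close>.\<close>

lemma fact_add_card:
  obtains K where "fact (CARD('p) + n) = CARD('p) * K"
    and "of_nat K = - (fact_mod n :: 'p::prime_card mod_ring)"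
proof -
  have "\<exists>K. fact (CARD('p) + n) = CARD('p) * K \<and> of_nat K = - (fact_mod n :: 'p mod_ring)"
  proof (induction n)
    case 0
    have "fact (CARD('p)) = CARD('p) * (fact (CARD('p) - 1) :: nat)"
      using fact_reduce[of "CARD('p)", where 'a = nat] by simp
    moreover have "of_nat (fact (CARD('p) - 1)) = - (fact_mod 0 :: 'p mod_ring)"
      using fact_mod_wilson by (simp add: fact_mod_def)
    ultimately show ?case by auto
  next
    case (Suc n)
    then obtain K where K: "fact (CARD('p) + n) = CARD('p) * K"
      "of_nat K = - (fact_mod n :: 'p mod_ring)" by blast
    have "fact (CARD('p) + Suc n) = CARD('p) * ((CARD('p) + Suc n) * K)"
      using K(1) by (simp add: algebra_simps)
    moreover have "of_nat ((CARD('p) + Suc n) * K) = - (fact_mod (Suc n) :: 'p mod_ring)"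
      unfolding of_nat_mult of_nat_add fact_mod_Suc K(2) of_nat_card_eq_0 by simp
    ultimately show ?case by blast
  qed
  then show thesis using that by blast
qed

section \<open>Reduction of the closed form modulo p\<close>

theorem theorem3p6:
  fixes p a b c :: nat
  assumes "p = CARD('p::prime_card)" and "odd p"
    and "0 < a" "a < p" and "0 < b" "b < p" and "0 < c" "c < p"
    and "a + b + c \<ge> 2 * p - 1"
  shows "(a + b + 2 * c \<le> 3 * p - 2 \<longrightarrow>
      (let E = - (fact_mod (2 * c) / fact_mod c) *
             ((fact_mod a * fact_mod (a + c - p) * fact_mod b * fact_mod (b + c - p)) /
              (fact_mod (a + b + c + 1 - 2 * p) * fact_mod (a + b + 2 * c + 1 - 2 * p)))
       in (S_bar a b c 2 2 :: 'p mod_ring) = E \<and> (E \<noteq> 0 \<longleftrightarrow> 2 * c < p))) \<and>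
     (3 * p - 1 \<le> a + b + 2 * c \<longrightarrow>
      2 * c > p \<and>
      (let E = - (fact_mod (2 * c - p) / fact_mod c) *
             ((fact_mod a * fact_mod (a + c - p) * fact_mod b * fact_mod (b + c - p)) /
              (fact_mod (a + b + c + 1 - 2 * p) * fact_mod (a + b + 2 * c + 1 - 3 * p)))
       in (S_bar a b c 2 2 :: 'p mod_ring) = E \<and> E \<noteq> 0))"
proof -
  \<comment> \<open>The factorial arguments of the closed form at \<open>n = 2 * p - 1\<close>;
    \<open>N\<close> is written as the reflection of \<open>a + c - p\<close>.\<close>
  define M N Q where "M = a + b + c + 1 - 2 * p" and "N = p - 1 - (a + c - p)"
    and "Q = a + b + 2 * c + 1 - 2 * p"
  define s where "s = S p a b c 2 2"
  have p: "2 < p"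
    using assms(1,2) prime_card[where 'a = 'p] by (metis even_numeral le_neq_implies_less prime_ge_2_nat)
  have p0: "int p \<noteq> 0" using p by simp
  obtain K1 where K1: "fact (p + (p - 1 - a)) = p * K1" "of_nat K1 = - (fact_mod (p - 1 - a) :: 'p mod_ring)"
    using fact_add_card[where 'p = 'p] unfolding assms(1) by metis
  obtain K2 where K2: "fact (p + (b + c - p)) = p * K2" "of_nat K2 = - (fact_mod (b + c - p) :: 'p mod_ring)"
    using fact_add_card[where 'p = 'p] unfolding assms(1) by metis
  \<comment> \<open>From \<open>a + b + c \<ge> 2 * p - 1\<close> and \<open>a, b < p\<close> follow
    \<open>a + c \<ge> p\<close> and \<open>b + c \<ge> p\<close>, so no subtraction
    truncates.\<close>
  have idx: "2 * p - 1 - a - c = N" "a + b + c - (2 * p - 1) = M" "2 * p - 1 - a = p + (p - 1 - a)"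
    "a + b + 2 * c - (2 * p - 1) = Q" "b + c = p + (b + c - p)"
    using assms(3-) by (auto simp: M_def N_def Q_def)
  have "s * (fact c * fact (2 * p - 1 - a - c) * fact (a + b + c - (2 * p - 1))
      * fact (2 * p - 1 - a) * fact (a + b + 2 * c - (2 * p - 1)))
      = (-1) ^ c * fact (2 * c) * fact b * fact (b + c)"
    unfolding s_def S_def using assms(3-) by (intro coeff_coeff_Phi_closed_form) auto
  then have "s * (fact c * fact N * fact M * of_nat (fact (p + (p - 1 - a))) * fact Q)
      = (-1) ^ c * fact (2 * c) * fact b * of_nat (fact (p + (b + c - p)))"
    unfolding idx(1,2,4) of_nat_fact idx(3,5)[symmetric] .
  then have "int p * (s * (fact c * fact N * fact M * int K1 * fact Q))
      = int p * ((-1) ^ c * fact (2 * c) * fact b * int K2)"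
    unfolding K1 K2 by (simp add: mult_ac)
  then have main: "s * (fact c * fact N * fact M * int K1 * fact Q)
      = (-1) ^ c * fact (2 * c) * fact b * int K2"
    using p0 by (simp only: mult_cancel_left) simp
  have S: "S_bar a b c 2 2 = (of_int s :: 'p mod_ring)"
    unfolding S_bar_def s_def assms(1) ..
  have of_fact: "of_int (fact n) = (fact_mod n :: 'p mod_ring)" for n
    by (metis fact_mod_def of_int_of_nat_eq of_nat_fact)
  have nz: "(fact_mod n :: 'p mod_ring) \<noteq> 0" if "n < p" for n
    using that by (simp add: fact_mod_eq_0_iff assms(1))
  have r1: "fact_mod a * fact_mod (p - 1 - a) = ((-1) ^ (a + 1) :: 'p mod_ring)"
    using assms(4) unfolding assms(1) by (rule fact_mod_reflect)
  have r2: "fact_mod (a + c - p) * fact_mod N = ((-1) ^ (a + c - p + 1) :: 'p mod_ring)"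
    using assms(3-) unfolding N_def assms(1) by (intro fact_mod_reflect) simp
  have "a + c \<ge> p" using assms(3-) by simp
  then have par: "even (a + c - p + 1) \<longleftrightarrow> even (a + c)"
    using assms(2) by auto
  \<comment> \<open>As p is odd, the total exponent has the parity of \<open>c + 1\<close>. This
    cancels the \<open>(-1) ^ c\<close> of the closed form and leaves the leading minus
    sign.\<close>
  have sgn: "(-1) ^ (a + 1) * (-1) ^ (a + c - p + 1) = (- ((-1) ^ c) :: 'p mod_ring)"
    using par by (auto simp: minus_one_power_iff simp del: power_Suc)
  \<comment> \<open>Common to both cases: \<open>T\<close> and \<open>R\<close> stand for what
    remains of \<open>(2 * c)!\<close> and \<open>Q!\<close>. Multiplying by \<open>a!\<close> and
    \<open>(a + c - p)!\<close> turns \<open>(p - 1 - a)!\<close> and \<open>N!\<close> into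
    signs.\<close>
  have solve: "of_int s = - (T / fact_mod c) * ((fact_mod a * fact_mod (a + c - p) * fact_mod b
      * fact_mod (b + c - p)) / (fact_mod M * R))"
    if eq: "of_int s * (fact_mod c * fact_mod N * fact_mod M * of_nat K1 * R)
      = (-1) ^ c * T * fact_mod b * of_nat K2" and R: "R \<noteq> 0"
    for T R :: "'p mod_ring"
  proof -
    have "(-1) ^ c * (of_int s * (fact_mod c * (fact_mod M * R)))
      = - ((-1) ^ (a + 1) * (-1) ^ (a + c - p + 1)) * (of_int s * (fact_mod c * (fact_mod M * R)))"
      unfolding sgn by simp
    also have "\<dots> = fact_mod a * fact_mod (a + c - p)
        * (of_int s * (fact_mod c * fact_mod N * fact_mod M * of_nat K1 * R))"
      unfolding r1[symmetric] r2[symmetric] K1(2) by (simp add: mult_ac)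
    also have "\<dots> = (-1) ^ c * - (T * (fact_mod a * fact_mod (a + c - p) * fact_mod b * fact_mod (b + c - p)))"
      unfolding eq K2(2) by (simp add: mult_ac)
    finally have e: "of_int s * (fact_mod c * (fact_mod M * R))
        = - (T * (fact_mod a * fact_mod (a + c - p) * fact_mod b * fact_mod (b + c - p)))"
      by (simp only: mult_cancel_left) simp
    have "fact_mod c * (fact_mod M * R) \<noteq> 0"
      using R assms(3-) by (simp add: nz M_def)
    then have "of_int s = - (T * (fact_mod a * fact_mod (a + c - p) * fact_mod b * fact_mod (b + c - p)))
        / (fact_mod c * (fact_mod M * R))"
      unfolding e[symmetric] by simp
    then show ?thesis by simp
  qed
  have nz': "fact_mod a * fact_mod (a + c - p) * fact_mod b * fact_mod (b + c - p) \<noteq> (0 :: 'p mod_ring)"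
    "fact_mod c \<noteq> (0 :: 'p mod_ring)" "fact_mod M \<noteq> (0 :: 'p mod_ring)"
    using assms(3-) by (simp_all add: nz M_def)
  show ?thesis
  proof (intro conjI impI)
    assume "a + b + 2 * c \<le> 3 * p - 2"
    then have Q0: "fact_mod Q \<noteq> (0 :: 'p mod_ring)"
      using p by (intro nz) (simp add: Q_def)
    have "(of_int (s * (fact c * fact N * fact M * int K1 * fact Q)) :: 'p mod_ring)
        = of_int ((-1) ^ c * fact (2 * c) * fact b * int K2)"
      unfolding main ..
    then have "of_int s * (fact_mod c * fact_mod N * fact_mod M * of_nat K1 * fact_mod Q)
        = (-1) ^ c * fact_mod (2 * c) * fact_mod b * (of_nat K2 :: 'p mod_ring)"
      by (simp only: of_int_mult of_int_power of_int_minus of_int_1 of_int_of_nat_eq of_fact)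
    note e = solve[OF this Q0]
    have "2 * c \<noteq> p" using assms(2) by auto
    \<comment> \<open>All other factors of \<open>E\<close> are units, so \<open>E\<close> vanishes
      exactly when p divides \<open>(2 * c)!\<close>.\<close>
    then have c2: "fact_mod (2 * c) \<noteq> (0 :: 'p mod_ring) \<longleftrightarrow> 2 * c < p"
      by (auto simp: fact_mod_eq_0_iff assms(1))
    show "let E = - (fact_mod (2 * c) / fact_mod c) *
             ((fact_mod a * fact_mod (a + c - p) * fact_mod b * fact_mod (b + c - p)) /
              (fact_mod (a + b + c + 1 - 2 * p) * fact_mod (a + b + 2 * c + 1 - 2 * p)))
       in (S_bar a b c 2 2 :: 'p mod_ring) = E \<and> (E \<noteq> 0 \<longleftrightarrow> 2 * c < p)"
      unfolding Let_def S M_def[symmetric] Q_def[symmetric] c2[symmetric]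
      using e nz' Q0 by simp
  next
    assume "3 * p - 1 \<le> a + b + 2 * c"
    then show c: "p < 2 * c" using assms(3-) by simp
  next
    assume h: "3 * p - 1 \<le> a + b + 2 * c"
    then have c: "p < 2 * c" using assms(3-) by simp
    define Q' where "Q' = a + b + 2 * c + 1 - 3 * p"
    \<comment> \<open>Since \<open>a, b, c < p\<close>, the number \<open>Q\<close> lies below
      \<open>2 * p\<close>, so \<open>Q!\<close> contains p exactly once.\<close>
    have Q': "p + Q' = Q" "Q' < p" using h assms(3-) p by (auto simp: Q_def Q'_def)
    have c': "p + (2 * c - p) = 2 * c" using c by simp
    obtain K3 where K3: "fact (p + Q') = p * K3" "of_nat K3 = - (fact_mod Q' :: 'p mod_ring)"
      using fact_add_card[where 'p = 'p] unfolding assms(1) by metis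
    obtain K4 where K4: "fact (p + (2 * c - p)) = p * K4" "of_nat K4 = - (fact_mod (2 * c - p) :: 'p mod_ring)"
      using fact_add_card[where 'p = 'p] unfolding assms(1) by metis
    have "fact Q = int p * int K3" "fact (2 * c) = int p * int K4"
      using arg_cong[OF K3(1), of int] arg_cong[OF K4(1), of int] unfolding Q' c' by simp_all
    \<comment> \<open>A second factor p, now from \<open>Q!\<close> and \<open>(2 * c)!\<close>, is
      cancelled over the integers.\<close>
    with main have "int p * (s * (fact c * fact N * fact M * int K1 * int K3))
        = int p * ((-1) ^ c * int K4 * fact b * int K2)"
      by (simp add: mult_ac)
    then have "s * (fact c * fact N * fact M * int K1 * int K3) = (-1) ^ c * int K4 * fact b * int K2"
      using p0 by (simp only: mult_cancel_left) simp
    then have "(of_int (s * (fact c * fact N * fact M * int K1 * int K3)) :: 'p mod_ring)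
        = of_int ((-1) ^ c * int K4 * fact b * int K2)"
      by simp
    then have "of_int s * (fact_mod c * fact_mod N * fact_mod M * of_nat K1 * of_nat K3)
        = (-1) ^ c * of_nat K4 * fact_mod b * (of_nat K2 :: 'p mod_ring)"
      by (simp only: of_int_mult of_int_power of_int_minus of_int_1 of_int_of_nat_eq of_fact)
    \<comment> \<open>The minus signs of \<open>K3\<close> and \<open>K4\<close> cancel, which gives
      the shape of \<open>solve\<close> with \<open>T = fact_mod (2 * c - p)\<close> and
      \<open>R = fact_mod Q'\<close>.\<close>
    then have eq: "of_int s * (fact_mod c * fact_mod N * fact_mod M * of_nat K1 * fact_mod Q')
        = (-1) ^ c * fact_mod (2 * c - p) * fact_mod b * (of_nat K2 :: 'p mod_ring)"
      unfolding K3(2) K4(2) by simp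
    have Q0: "fact_mod Q' \<noteq> (0 :: 'p mod_ring)" using Q'(2) by (rule nz)
    note e = solve[OF eq Q0]
    have c2: "fact_mod (2 * c - p) \<noteq> (0 :: 'p mod_ring)" using c assms(8) by (intro nz) simp
    show "let E = - (fact_mod (2 * c - p) / fact_mod c) *
             ((fact_mod a * fact_mod (a + c - p) * fact_mod b * fact_mod (b + c - p)) /
              (fact_mod (a + b + c + 1 - 2 * p) * fact_mod (a + b + 2 * c + 1 - 3 * p)))
       in (S_bar a b c 2 2 :: 'p mod_ring) = E \<and> E \<noteq> 0"
      unfolding Let_def S M_def[symmetric] Q'_def[symmetric]
      using e nz' Q0 c2 by simp
  qed
qed

end
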